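(* Let $X\subset\mathcal{H}(\mathbb{D})$ be a Banach space of analytic functions on the unit disk satisfying the axioms: [Ax1] all point evaluation functionals $\Lambda_z$, $z\in\mathbb{D}$, are bounded on $X$; [Ax2] the set of all polynomials in $z$ is contained in $X$ and dense in $X$ (in $\|\cdot\|_X$); [Ax3] the shift operator $S=M_z$, $Sf(z)=zf(z)$, is bounded on $X$; [Ax4] $\limsup_{n\to\infty}\|z^n\|_X^{1/n}=1$. Suppose that a weighted composition operator $T_{F,\varphi}$ is bounded on $X$. (a) If $T_{F,\varphi}$ is invertible on $X$, then its composition symbol $\varphi$ is an automorphism of $\mathbb{D}$, the multiplication symbol $F$ does not vanish in $\mathbb{D}$, and the inverse operator $T_{F,\varphi}^{-1}$ is another weighted composition operator $T_{G,\psi}$, whose symbols are $$G=\frac{1}{F\circ\varphi^{-1}},\qquad \psi=\varphi^{-1}.$$ (b) Assume in addition: [Ax5] every disk automorphism induces a bounded composition operator on $X$. Then $T_{F,\varphi}$ is invertible on $X$ if and only if its composition symbol $\varphi$ is an automorphism of $\mathbb{D}$, the multiplication symbol $F$ does not vanish in $\mathbb{D}$, and $1/F\in\mathcal{M}(X)$. If this is the case, then $F$ is also a self-multiplier of $X$ (that is, $F\in\mathcal{M}(X)$) and the inverse operator is $T_{G,\psi}$ with $G=\frac{1}{F\circ\varphi^{-1}}$ and $\psi=\varphi^{-1}$.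
   Context: $\mathbb{D}$ is the open unit disk and $\mathcal{H}(\mathbb{D})$ the algebra of analytic functions on it. $\Lambda_z(f)=f(z)$ for $f\in X$. For $F\in\mathcal{H}(\mathbb{D})$ and an analytic map $\varphi\colon\mathbb{D}\to\mathbb{D}$, the weighted composition operator with multiplication symbol $F$ and composition symbol $\varphi$ is $T_{F,\varphi}f=F\cdot(f\circ\varphi)$. The composition operator with symbol $\varphi$ is $C_\varphi f=f\circ\varphi$. An automorphism of $\mathbb{D}$ is a bijective analytic map of $\mathbb{D}$ onto itself. $\mathcal{M}(X)$ is the set of pointwise multipliers (self-multipliers) of $X$: functions $F\in\mathcal{H}(\mathbb{D})$ such that $Ff\in X$ for all $f\in X$ (the operator $M_Ff=Ff$ is then automatically bounded on $X$). *)

theory Defs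
  imports "HOL-Complex_Analysis.Complex_Analysis"
begin

abbreviation disk :: "complex set"
  where "disk \<equiv> ball 0 1"

text \<open>
  A function on the disk is represented by its extension by zero to the whole plane. Equality on
  the disk is then equality of functions, and pointwise sums and multiples stay in normal form.
\<close>

definition on_disk :: "(complex \<Rightarrow> complex) \<Rightarrow> complex \<Rightarrow> complex"
  where "on_disk f = (\<lambda>z. if z \<in> disk then f z else 0)"

definition analytic_on_disk :: "(complex \<Rightarrow> complex) set"
  where "analytic_on_disk = {f. f holomorphic_on disk \<and> (\<forall>z. z \<notin> disk \<longrightarrow> f z = 0)}"

text \<open>
  A complex Banach space whose carrier \<open>X\<close> is a linear subspace of the analytic functions on
  the disk; only the values of the norm \<open>N\<close> on \<open>X\<close> matter.
\<close>

locale analytic_banach_space =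
  fixes X :: "(complex \<Rightarrow> complex) set" and N :: "(complex \<Rightarrow> complex) \<Rightarrow> real"
  assumes analytic: "X \<subseteq> analytic_on_disk"
    and zero_mem: "(\<lambda>z. 0) \<in> X"
    and add_mem: "\<And>f g. f \<in> X \<Longrightarrow> g \<in> X \<Longrightarrow> (\<lambda>z. f z + g z) \<in> X"
    and scale_mem: "\<And>c f. f \<in> X \<Longrightarrow> (\<lambda>z. c * f z) \<in> X"
    and norm_nonneg: "\<And>f. f \<in> X \<Longrightarrow> 0 \<le> N f"
    and norm_eq_zero: "\<And>f. f \<in> X \<Longrightarrow> N f = 0 \<longleftrightarrow> f = (\<lambda>z. 0)"
    and norm_triangle: "\<And>f g. f \<in> X \<Longrightarrow> g \<in> X \<Longrightarrow> N (\<lambda>z. f z + g z) \<le> N f + N g"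
    and norm_scale: "\<And>c f. f \<in> X \<Longrightarrow> N (\<lambda>z. c * f z) = cmod c * N f"
    and complete: "\<And>s :: nat \<Rightarrow> complex \<Rightarrow> complex.
        (\<And>n. s n \<in> X) \<Longrightarrow>
        (\<forall>e>0. \<exists>n0. \<forall>m\<ge>n0. \<forall>n\<ge>n0. N (\<lambda>z. s m z - s n z) < e) \<Longrightarrow>
        \<exists>f\<in>X. (\<lambda>n. N (\<lambda>z. s n z - f z)) \<longlonglongrightarrow> 0"

definition bounded_operator_on ::
    "(complex \<Rightarrow> complex) set \<Rightarrow> ((complex \<Rightarrow> complex) \<Rightarrow> real) \<Rightarrow>
      ((complex \<Rightarrow> complex) \<Rightarrow> complex \<Rightarrow> complex) \<Rightarrow> bool"
  where "bounded_operator_on X N T \<longleftrightarrow>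
    (\<forall>f\<in>X. T f \<in> X) \<and>
    (\<forall>f\<in>X. \<forall>g\<in>X. T (\<lambda>z. f z + g z) = (\<lambda>z. T f z + T g z)) \<and>
    (\<forall>c. \<forall>f\<in>X. T (\<lambda>z. c * f z) = (\<lambda>z. c * T f z)) \<and>
    (\<exists>C. \<forall>f\<in>X. N (T f) \<le> C * N f)"

definition inverse_operator_on ::
    "(complex \<Rightarrow> complex) set \<Rightarrow> ((complex \<Rightarrow> complex) \<Rightarrow> real) \<Rightarrow>
      ((complex \<Rightarrow> complex) \<Rightarrow> complex \<Rightarrow> complex) \<Rightarrow>
      ((complex \<Rightarrow> complex) \<Rightarrow> complex \<Rightarrow> complex) \<Rightarrow> bool"
  where "inverse_operator_on X N T R \<longleftrightarrow>
    bounded_operator_on X N R \<and> (\<forall>f\<in>X. R (T f) = f \<and> T (R f) = f)"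

definition invertible_operator_on ::
    "(complex \<Rightarrow> complex) set \<Rightarrow> ((complex \<Rightarrow> complex) \<Rightarrow> real) \<Rightarrow>
      ((complex \<Rightarrow> complex) \<Rightarrow> complex \<Rightarrow> complex) \<Rightarrow> bool"
  where "invertible_operator_on X N T \<longleftrightarrow>
    bounded_operator_on X N T \<and> (\<exists>R. inverse_operator_on X N T R)"

definition mult_op :: "(complex \<Rightarrow> complex) \<Rightarrow> (complex \<Rightarrow> complex) \<Rightarrow> complex \<Rightarrow> complex"
  where "mult_op F f = on_disk (\<lambda>z. F z * f z)"

definition comp_op :: "(complex \<Rightarrow> complex) \<Rightarrow> (complex \<Rightarrow> complex) \<Rightarrow> complex \<Rightarrow> complex"
  where "comp_op \<phi> f = on_disk (f \<circ> \<phi>)"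

definition weighted_comp_op ::
    "(complex \<Rightarrow> complex) \<Rightarrow> (complex \<Rightarrow> complex) \<Rightarrow> (complex \<Rightarrow> complex) \<Rightarrow> complex \<Rightarrow> complex"
  where "weighted_comp_op F \<phi> f = on_disk (\<lambda>z. F z * (f \<circ> \<phi>) z)"

text \<open>Symbols may be arbitrary off the disk; the operators above ignore those values.\<close>

definition weighted_comp_symbols :: "(complex \<Rightarrow> complex) \<Rightarrow> (complex \<Rightarrow> complex) \<Rightarrow> bool"
  where "weighted_comp_symbols F \<phi> \<longleftrightarrow>
    F holomorphic_on disk \<and> \<phi> holomorphic_on disk \<and> \<phi> ` disk \<subseteq> disk"

definition disk_automorphism :: "(complex \<Rightarrow> complex) \<Rightarrow> bool"
  where "disk_automorphism \<phi> \<longleftrightarrow> \<phi> holomorphic_on disk \<and> bij_betw \<phi> disk disk"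

definition multipliers :: "(complex \<Rightarrow> complex) set \<Rightarrow> (complex \<Rightarrow> complex) set"
  where "multipliers X = {F. F holomorphic_on disk \<and> (\<forall>f\<in>X. mult_op F f \<in> X)}"

end

theory Submission
  imports Defs
begin

text \<open>
  Let \<open>T\<close> be the weighted composition operator, \<open>R\<close> its inverse, and put \<open>a = R 1\<close> and
  \<open>b = R z\<close>. Since \<open>T (R f) = f\<close>, the identity \<open>F(z) (R f)(\<phi> z) = f(z)\<close> holds on the disk for
  every \<open>f\<close> in \<open>X\<close>. For \<open>f = 1\<close> and \<open>f = z\<close> it says that \<open>F\<close> has no zeros and that
  \<open>z = b(\<phi> z) / a(\<phi> z)\<close>. So \<open>\<phi>\<close> is injective, and \<open>\<psi> = b / a\<close> continues its inverse
  meromorphically from the open set \<open>\<phi> ` disk\<close> to the whole disk.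

  What remains is that \<open>\<psi>\<close> maps the disk into itself, because then \<open>\<phi> (\<psi> w) = w\<close> extends from
  \<open>\<phi> ` disk\<close> to the disk by the identity theorem and \<open>\<phi>\<close> is onto. The identity theorem also gives
  \<open>R (z^k) = a \<psi>^k\<close> on the disk. At a point \<open>w\<close> with \<open>a(w) \<noteq> 0\<close>, boundedness of \<open>R\<close> and of point
  evaluation turn this into \<open>\<bar>a(w)\<bar> \<bar>\<psi>(w)\<bar>^k \<le> C N(z^k)\<close>, and the growth condition on the norms of
  the powers forces \<open>\<bar>\<psi>(w)\<bar> \<le> 1\<close>. Hence \<open>\<bar>R (z^k)\<bar> \<le> \<bar>a\<bar>\<close> off the zeros of \<open>a\<close>, and by continuity
  everywhere. A zero \<open>w\<close> of \<open>a\<close> would thus make \<open>f \<mapsto> (R f)(w)\<close> vanish on the polynomials, so on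
  all of \<open>X\<close> by density, although \<open>R\<close> is onto and \<open>X\<close> contains the constants. So \<open>\<psi>\<close> is
  holomorphic and bounded by one; being nonconstant, it has values in the open disk by the maximum
  principle. This argument is \<open>invertible_weighted_comp_op_imp\<close>.

  Once \<open>\<phi>\<close> is an automorphism and \<open>F\<close> has no zeros, the operator with symbols \<open>1 / (F \<circ> \<psi>)\<close> and
  \<open>\<psi>\<close>, where \<open>\<psi>\<close> is the inverse map of \<open>\<phi>\<close>, inverts \<open>T\<close> pointwise
  (\<open>weighted_comp_op_inverse\<close>), so it agrees with any inverse of \<open>T\<close> on \<open>X\<close>. If automorphisms
  induce bounded composition operators, this operator is multiplication by \<open>1 / F\<close> followed by
  composition with \<open>\<psi>\<close>; conversely, multiplication by \<open>1 / F\<close> and by \<open>F\<close> are obtained from it and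
  from \<open>T\<close> by composing with \<open>\<phi>\<close> and \<open>\<psi>\<close>. The multiplier condition
  therefore says exactly that the pointwise inverse maps \<open>X\<close> into \<open>X\<close>. Its boundedness is then
  Banach's bounded inverse theorem (\<open>bounded_inverse\<close>), proved here from the Baire category theorem.
\<close>

section \<open>Bounded inverses of bounded bijections\<close>

context analytic_banach_space
begin

lemma diff_mem:
  assumes "f \<in> X" "g \<in> X" shows "(\<lambda>z. f z - g z) \<in> X"
  using add_mem[OF assms(1) scale_mem[OF assms(2), of "-1"]] by simp

lemma norm_minus_commute:
  assumes "f \<in> X" "g \<in> X" shows "N (\<lambda>z. f z - g z) = N (\<lambda>z. g z - f z)"
  using norm_scale[OF diff_mem[OF assms], of "-1"] by (simp add: algebra_simps)

lemma norm_diff_triangle: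
  assumes "f \<in> X" "g \<in> X" "h \<in> X"
  shows "N (\<lambda>z. f z - h z) \<le> N (\<lambda>z. f z - g z) + N (\<lambda>z. g z - h z)"
  using norm_triangle[OF diff_mem[OF assms(1,2)] diff_mem[OF assms(2,3)]] by simp

lemma norm_triangle_diff:
  assumes "f \<in> X" "g \<in> X" shows "N (\<lambda>z. f z - g z) \<le> N f + N g"
  using norm_triangle[OF assms(1) scale_mem[OF assms(2), of "-1"]] norm_scale[OF assms(2), of "-1"]
  by simp

lemma norm_zero: "N (\<lambda>z. 0) = 0"
  using norm_eq_zero[OF zero_mem] by simp

lemma operator_mem: "bounded_operator_on X N T \<Longrightarrow> f \<in> X \<Longrightarrow> T f \<in> X"
  unfolding bounded_operator_on_def by blast

lemma operator_add:
  "bounded_operator_on X N T \<Longrightarrow> f \<in> X \<Longrightarrow> g \<in> X \<Longrightarrow> T (\<lambda>z. f z + g z) = (\<lambda>z. T f z + T g z)"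
  by (simp add: bounded_operator_on_def)

lemma operator_scale:
  "bounded_operator_on X N T \<Longrightarrow> f \<in> X \<Longrightarrow> T (\<lambda>z. c * f z) = (\<lambda>z. c * T f z)"
  by (simp add: bounded_operator_on_def)

lemma operator_diff:
  assumes T: "bounded_operator_on X N T" and fg: "f \<in> X" "g \<in> X"
  shows "T (\<lambda>z. f z - g z) = (\<lambda>z. T f z - T g z)"
  using operator_add[OF T fg(1) scale_mem[OF fg(2), of "-1"]] operator_scale[OF T fg(2), of "-1"]
  by simp

lemma operator_bound:
  assumes "bounded_operator_on X N T"
  obtains C where "C > 0" "\<And>f. f \<in> X \<Longrightarrow> N (T f) \<le> C * N f"
proof -
  obtain C where C: "\<And>f. f \<in> X \<Longrightarrow> N (T f) \<le> C * N f"
    using assms unfolding bounded_operator_on_def by blast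
  have "N (T f) \<le> (\<bar>C\<bar> + 1) * N f" if "f \<in> X" for f
    using C[OF that] mult_right_mono[of C "\<bar>C\<bar> + 1" "N f"] norm_nonneg[OF that] by linarith
  then show ?thesis by (intro that[of "\<bar>C\<bar> + 1"]) auto
qed

text \<open>
  The distance is zero off \<open>X\<close> because \<^locale>\<open>Metric_space\<close> demands nonnegativity and symmetry of
  arbitrary arguments, and \<open>N\<close> is unconstrained there.
\<close>

definition norm_dist :: "(complex \<Rightarrow> complex) \<Rightarrow> (complex \<Rightarrow> complex) \<Rightarrow> real"
  where "norm_dist f g = (if f \<in> X \<and> g \<in> X then N (\<lambda>z. f z - g z) else 0)"

lemma Metric_space_norm_dist: "Metric_space X norm_dist"
proof
  fix f g :: "complex \<Rightarrow> complex"
  show "0 \<le> norm_dist f g" by (simp add: norm_dist_def norm_nonneg diff_mem)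
  show "norm_dist f g = norm_dist g f" by (auto simp: norm_dist_def intro: norm_minus_commute)
next
  fix f g assume "f \<in> X" "g \<in> X"
  then show "(norm_dist f g = 0) = (f = g)"
    by (simp add: norm_dist_def norm_eq_zero diff_mem fun_eq_iff)
next
  fix f g h assume "f \<in> X" "g \<in> X" "h \<in> X"
  then show "norm_dist f h \<le> norm_dist f g + norm_dist g h"
    by (simp add: norm_dist_def norm_diff_triangle)
qed

interpretation M: Metric_space X norm_dist
  by (rule Metric_space_norm_dist)

lemma mcomplete_norm_dist: "M.mcomplete"
  unfolding M.mcomplete_def
proof (intro allI impI)
  fix s assume "M.MCauchy s"
  then have s: "\<And>n. s n \<in> X"
    and cau: "\<forall>e>0. \<exists>n0. \<forall>m\<ge>n0. \<forall>n\<ge>n0. N (\<lambda>z. s m z - s n z) < e"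
    unfolding M.MCauchy_def by (auto simp: norm_dist_def range_subsetD)
  obtain f where f: "f \<in> X" "(\<lambda>n. N (\<lambda>z. s n z - f z)) \<longlonglongrightarrow> 0"
    using complete[OF s cau] by auto
  have "\<forall>\<^sub>F n in sequentially. s n \<in> X \<and> norm_dist (s n) f < e" if "e > 0" for e
    using order_tendstoD(2)[OF f(2) that] by (simp add: norm_dist_def s f(1))
  then show "\<exists>f. limitin M.mtopology s f sequentially"
    using f(1) unfolding M.limitin_metric by auto
qed

text \<open>
  The category step of the bounded inverse theorem, for an arbitrary seminorm \<open>p\<close>. The closures of
  the sets \<open>{p \<le> n}\<close> cover \<open>X\<close>, so one of them contains a ball around some \<open>f0\<close>. As a difference
  of two points near \<open>f0\<close>, every small vector is a limit of vectors with \<open>p \<le> 2 n\<close>; scaling makes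
  the bound on \<open>p\<close> proportional to the norm.
\<close>

lemma seminorm_approximation:
  fixes p :: "(complex \<Rightarrow> complex) \<Rightarrow> real"
  assumes p_nonneg: "\<And>f. f \<in> X \<Longrightarrow> 0 \<le> p f"
    and p_diff: "\<And>f g. f \<in> X \<Longrightarrow> g \<in> X \<Longrightarrow> p (\<lambda>z. f z - g z) \<le> p f + p g"
    and p_scale: "\<And>c f. f \<in> X \<Longrightarrow> p (\<lambda>z. c * f z) = cmod c * p f"
  obtains K where "K \<ge> 0"
    "\<And>f e. f \<in> X \<Longrightarrow> e > 0 \<Longrightarrow> \<exists>g\<in>X. N (\<lambda>z. f z - g z) < e \<and> p g \<le> K * N f"
proof -
  define A where "A n = M.mtopology closure_of {f \<in> X. p f \<le> real n}" for n
  have "X \<subseteq> (\<Union>n. A n)"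
  proof
    fix f assume f: "f \<in> X"
    have "p f \<le> real (nat \<lceil>p f\<rceil>)" by linarith
    then have "f \<in> A (nat \<lceil>p f\<rceil>)"
      unfolding A_def using f closure_of_subset[of "{g \<in> X. p g \<le> real (nat \<lceil>p f\<rceil>)}" M.mtopology]
      by auto
    then show "f \<in> (\<Union>n. A n)" by blast
  qed
  then have "M.mtopology interior_of X \<subseteq> M.mtopology interior_of (\<Union>n. A n)"
    by (rule interior_of_mono)
  then have "M.mtopology interior_of (\<Union>n. A n) \<noteq> {}"
    using zero_mem by (metis M.topspace_mtopology empty_iff interior_of_topspace subset_empty)
  then obtain n where "M.mtopology interior_of (A n) \<noteq> {}"
    using M.metric_Baire_category_alt[OF mcomplete_norm_dist, of "range A"]
    unfolding A_def by fastforce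
  then obtain f0 r where f0: "f0 \<in> X" and r: "r > 0" "M.mball f0 r \<subseteq> A n"
    unfolding M.metric_interior_of by auto
  have near: "\<exists>g\<in>X. p g \<le> real n \<and> N (\<lambda>z. u z - g z) < d"
    if u: "u \<in> X" "N (\<lambda>z. f0 z - u z) < r" and d: "d > 0" for u d
  proof -
    have "u \<in> M.mball f0 r" using u f0 by (simp add: norm_dist_def)
    then have "u \<in> A n" using r by blast
    then obtain g where "g \<in> X" "p g \<le> real n" "norm_dist u g < d"
      using d unfolding A_def M.metric_closure_of by auto
    then show ?thesis using u(1) by (auto simp: norm_dist_def)
  qed
  show ?thesis
  proof (rule that[of "4 * real n / r"])
    show "0 \<le> 4 * real n / r" using r by simp
    fix f and e :: real assume f: "f \<in> X" and e: "e > 0"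
    show "\<exists>g\<in>X. N (\<lambda>z. f z - g z) < e \<and> p g \<le> 4 * real n / r * N f"
    proof (cases "N f = 0")
      case True
      have "p (\<lambda>z. 0) = 0" using p_scale[OF zero_mem, of 0] by simp
      then show ?thesis using True e zero_mem by (intro bexI[of _ "\<lambda>z. 0"]) auto
    next
      case False
      then have Nf: "N f > 0" using norm_nonneg[OF f] by linarith
      \<comment> \<open>The multiple of \<open>f\<close> by \<open>t\<close> has norm \<open>r / 2\<close>, so adding it to \<open>f0\<close> stays in the ball.\<close>
      define t where "t = r / (2 * N f)"
      have t: "t > 0" using r Nf by (simp add: t_def)
      have tf: "(\<lambda>z. of_real t * f z) \<in> X" by (rule scale_mem[OF f])
      have f0tf: "(\<lambda>z. f0 z + of_real t * f z) \<in> X" by (rule add_mem[OF f0 tf])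
      have "N (\<lambda>z. of_real t * f z) = t * N f"
        using norm_scale[OF f, of "of_real t"] t by simp
      then have Ntf: "N (\<lambda>z. of_real t * f z) = r / 2" using Nf by (simp add: t_def)
      have d: "e * t / 2 > 0" using e t by simp
      have "N (\<lambda>z. f0 z - (f0 z + of_real t * f z)) = N (\<lambda>z. of_real t * f z)"
        using norm_scale[OF tf, of "-1"] by simp
      then have "N (\<lambda>z. f0 z - (f0 z + of_real t * f z)) < r" using Ntf r by simp
      from near[OF f0tf this d] obtain g1 where g1: "g1 \<in> X" "p g1 \<le> real n"
        "N (\<lambda>z. f0 z + of_real t * f z - g1 z) < e * t / 2" by blast
      have "N (\<lambda>z. f0 z - f0 z) < r" using r norm_zero by simp
      from near[OF f0 this d] obtain g2 where g2: "g2 \<in> X" "p g2 \<le> real n"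
        "N (\<lambda>z. f0 z - g2 z) < e * t / 2" by blast
      define g where "g = (\<lambda>z. of_real (1 / t) * (g1 z - g2 z))"
      have g: "g \<in> X" unfolding g_def by (intro scale_mem diff_mem g1 g2)
      have "N (\<lambda>z. (f0 z + of_real t * f z - g1 z) - (f0 z - g2 z)) < e * t"
        using norm_triangle_diff[OF diff_mem[OF f0tf g1(1)] diff_mem[OF f0 g2(1)]] g1(3) g2(3)
        by linarith
      then have A: "N (\<lambda>z. of_real t * f z - (g1 z - g2 z)) < e * t" by (simp add: algebra_simps)
      have "(\<lambda>z. f z - g z) = (\<lambda>z. of_real (1 / t) * (of_real t * f z - (g1 z - g2 z)))"
        using t by (simp add: g_def fun_eq_iff field_simps)
      then have "N (\<lambda>z. f z - g z) = (1 / t) * N (\<lambda>z. of_real t * f z - (g1 z - g2 z))"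
        using norm_scale[OF diff_mem[OF tf diff_mem[OF g1(1) g2(1)]], of "of_real (1 / t)"] t
        by (simp add: norm_divide)
      then have B: "N (\<lambda>z. f z - g z) < e"
        using mult_strict_left_mono[OF A, of "1 / t"] t by (simp del: of_real_divide)
      have "p g = (1 / t) * p (\<lambda>z. g1 z - g2 z)"
        unfolding g_def using p_scale[OF diff_mem[OF g1(1) g2(1)], of "of_real (1 / t)"] t
        by (simp add: norm_divide)
      also have "\<dots> \<le> (1 / t) * (2 * real n)"
        using p_diff[OF g1(1) g2(1)] g1(2) g2(2) t by (intro mult_left_mono) auto
      also have "\<dots> = 4 * real n / r * N f" using r Nf by (simp add: t_def field_simps)
      finally show ?thesis using g B by blast
    qed
  qed
qed

text \<open>
  Approximating \<open>f\<close>, then the remainder, then the next remainder, each time to within half of the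
  previous error, writes \<open>f\<close> as a series whose terms have images under \<open>R\<close> of geometrically
  decreasing norm. By completeness these images sum to some \<open>g\<close> of norm at most \<open>2 K N f\<close>, and
  continuity of \<open>T\<close> gives \<open>T g = f\<close>, that is, \<open>R f = g\<close>.
\<close>

lemma bounded_inverse:
  assumes T: "bounded_operator_on X N T"
    and R: "\<And>f. f \<in> X \<Longrightarrow> R f \<in> X" "\<And>f. f \<in> X \<Longrightarrow> T (R f) = f" "\<And>f. f \<in> X \<Longrightarrow> R (T f) = f"
  shows "bounded_operator_on X N R"
proof -
  have R_add: "R (\<lambda>z. f z + g z) = (\<lambda>z. R f z + R g z)" if "f \<in> X" "g \<in> X" for f g
  proof -
    have "T (\<lambda>z. R f z + R g z) = (\<lambda>z. T (R f) z + T (R g) z)"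
      using T R(1) that unfolding bounded_operator_on_def by blast
    then show ?thesis using R(3)[OF add_mem[OF R(1) R(1), OF that]] by (simp add: R(2) that)
  qed
  have R_scale: "R (\<lambda>z. c * f z) = (\<lambda>z. c * R f z)" if "f \<in> X" for f c
  proof -
    have "T (\<lambda>z. c * R f z) = (\<lambda>z. c * T (R f) z)"
      using T R(1) that unfolding bounded_operator_on_def by blast
    then show ?thesis using R(3)[OF scale_mem[OF R(1), OF that], of c] by (simp add: R(2) that)
  qed
  have R_diff: "R (\<lambda>z. f z - g z) = (\<lambda>z. R f z - R g z)" if "f \<in> X" "g \<in> X" for f g
    using R_add[OF that(1) scale_mem[OF that(2), of "-1"]] R_scale[OF that(2), of "-1"] by simp
  obtain K where K: "K \<ge> 0" and
    approx: "\<And>f e. f \<in> X \<Longrightarrow> e > 0 \<Longrightarrow> \<exists>g\<in>X. N (\<lambda>z. f z - g z) < e \<and> N (R g) \<le> K * N f"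
  proof (rule seminorm_approximation[of "\<lambda>f. N (R f)"])
    show "N (R (\<lambda>z. f z - g z)) \<le> N (R f) + N (R g)" if "f \<in> X" "g \<in> X" for f g
      using norm_triangle_diff[OF R(1) R(1), OF that] by (simp add: R_diff that)
  qed (use norm_scale R(1) in \<open>auto simp: R_scale norm_nonneg\<close>)
  obtain C where C: "C > 0" "\<And>f. f \<in> X \<Longrightarrow> N (T f) \<le> C * N f"
    using operator_bound[OF T] by blast
  have "N (R f) \<le> 2 * K * N f" if f: "f \<in> X" for f
  proof (cases "N f = 0")
    case True
    then have "f = (\<lambda>z. 0)" using norm_eq_zero f by blast
    moreover have "R (\<lambda>z. 0) = (\<lambda>z. 0)" using R_scale[OF zero_mem, of 0] by simp
    ultimately show ?thesis using norm_zero by simp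
  next
    case False
    then have Nf: "N f > 0" using norm_nonneg[OF f] by linarith
    \<comment> \<open>\<open>r n\<close> is the remainder of \<open>f\<close> after \<open>n\<close> approximation steps.\<close>
    obtain r where r0: "r 0 = f" and rX: "\<And>n. r n \<in> X" and rN: "\<And>n. N (r n) \<le> N f / 2 ^ n"
      and rR: "\<And>n. N (R (\<lambda>z. r n z - r (Suc n) z)) \<le> K * N f / 2 ^ n"
    proof -
      let ?P = "\<lambda>n g. g \<in> X \<and> N g \<le> N f / 2 ^ n \<and> (n = 0 \<longrightarrow> g = f)"
      let ?Q = "\<lambda>n g h. N (R (\<lambda>z. g z - h z)) \<le> K * N f / 2 ^ n"
      have "\<exists>h. ?P (Suc n) h \<and> ?Q n g h" if g: "?P n g" for n g
      proof -
        obtain k where k: "k \<in> X" "N (\<lambda>z. g z - k z) < N f / 2 ^ Suc n" "N (R k) \<le> K * N g"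
          using approx[of g "N f / 2 ^ Suc n"] g Nf by auto
        have "K * N g \<le> K * N f / 2 ^ n"
          using mult_left_mono[of "N g" "N f / 2 ^ n" K] g K by simp
        then show ?thesis
          using k g diff_mem by (intro exI[of _ "\<lambda>z. g z - k z"]) auto
      qed
      moreover have "?P 0 f" using f by simp
      ultimately have "\<exists>r. \<forall>n. ?P n (r n) \<and> ?Q n (r n) (r (Suc n))"
        using dependent_nat_choice[of ?P ?Q] by blast
      then show ?thesis using that by blast
    qed
    define s where "s n = R (\<lambda>z. f z - r n z)" for n
    have sX: "s n \<in> X" for n unfolding s_def by (intro R diff_mem f rX)
    have s_diff: "(\<lambda>z. s m z - s n z) = R (\<lambda>z. r n z - r m z)" for m n
      unfolding s_def by (simp add: R_diff f rX diff_mem)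
    define B where "B = 2 * K * N f"
    have B: "B \<ge> 0" unfolding B_def using K Nf by simp
    \<comment> \<open>Telescoping form of the geometric tail, which is what the induction on \<open>j\<close> reproduces.\<close>
    have tail: "N (\<lambda>z. s (m + j) z - s m z) \<le> B / 2 ^ m - B / 2 ^ (m + j)" for m j
    proof (induction j)
      case 0 then show ?case by (simp add: norm_zero)
    next
      case (Suc j)
      have "N (\<lambda>z. s (Suc (m + j)) z - s (m + j) z) \<le> B / 2 ^ (m + j) - B / 2 ^ Suc (m + j)"
        using rR[of "m + j"] by (simp add: s_diff B_def field_simps)
      then show ?case
        using Suc norm_diff_triangle[OF sX sX sX, of "m + Suc j" m "m + j"] by simp
    qed
    have B_null: "(\<lambda>m. D / 2 ^ m) \<longlonglongrightarrow> 0" for D :: real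
      using tendsto_mult_right_zero[OF LIMSEQ_power_zero[of "1/2 :: real"], of D]
      by (simp add: power_divide)
    have cauchy: "\<exists>n0. \<forall>m\<ge>n0. \<forall>n\<ge>n0. N (\<lambda>z. s m z - s n z) < e" if e: "e > 0" for e
    proof -
      obtain n0 where n0: "B / 2 ^ n0 < e / 2"
        using order_tendstoD(2)[OF B_null, of "e / 2" B] e by (auto simp: eventually_sequentially)
      have near: "N (\<lambda>z. s m z - s n0 z) < e / 2" if m: "m \<ge> n0" for m
      proof -
        have "B / 2 ^ m \<ge> 0" using B by simp
        moreover have "N (\<lambda>z. s m z - s n0 z) \<le> B / 2 ^ n0 - B / 2 ^ m"
          using tail[of n0 "m - n0"] m by simp
        ultimately show ?thesis using n0 by linarith
      qed
      have "N (\<lambda>z. s m z - s n z) < e" if mn: "m \<ge> n0" "n \<ge> n0" for m n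
        using norm_diff_triangle[OF sX[of m] sX[of n0] sX[of n]] near[OF mn(1)] near[OF mn(2)]
          norm_minus_commute[OF sX[of n0] sX[of n]] by linarith
      then show ?thesis by blast
    qed
    have "\<exists>g\<in>X. (\<lambda>n. N (\<lambda>z. s n z - g z)) \<longlonglongrightarrow> 0"
      by (rule complete[OF sX]) (use cauchy in simp)
    then obtain g where g: "g \<in> X" "(\<lambda>n. N (\<lambda>z. s n z - g z)) \<longlonglongrightarrow> 0" by (elim bexE)
    have "N (\<lambda>z. f z - T g z) \<le> 0"
    proof (rule tendsto_lowerbound)
      show "(\<lambda>n. N f / 2 ^ n + C * N (\<lambda>z. s n z - g z)) \<longlonglongrightarrow> 0"
        using tendsto_add[OF B_null[of "N f"] tendsto_mult_right_zero[OF g(2), of C]] by simp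
      have TgX: "T g \<in> X" using T g(1) unfolding bounded_operator_on_def by blast
      have TsX: "T (s n) \<in> X" for n using T sX unfolding bounded_operator_on_def by blast
      have "N (\<lambda>z. f z - T g z) \<le> N f / 2 ^ n + C * N (\<lambda>z. s n z - g z)" for n
      proof -
        have "T (s n) = (\<lambda>z. f z - r n z)" unfolding s_def by (rule R(2)[OF diff_mem[OF f rX]])
        then have "N (\<lambda>z. f z - T (s n) z) \<le> N f / 2 ^ n" using rN by simp
        moreover have "N (\<lambda>z. T (s n) z - T g z) \<le> C * N (\<lambda>z. s n z - g z)"
          using C(2)[OF diff_mem[OF sX g(1)], of n] by (simp add: operator_diff[OF T sX g(1)])
        ultimately show ?thesis
          using norm_diff_triangle[OF f TsX TgX, of n] by linarith
      qed
      then show "\<forall>\<^sub>F n in sequentially. N (\<lambda>z. f z - T g z) \<le> N f / 2 ^ n + C * N (\<lambda>z. s n z - g z)"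
        by simp
    qed simp
    moreover have "T g \<in> X" using T g(1) unfolding bounded_operator_on_def by blast
    ultimately have "(\<lambda>z. f z - T g z) = (\<lambda>z. 0)"
      using norm_eq_zero norm_nonneg diff_mem f by (meson order_antisym)
    then have "T g = f" by (auto simp: fun_eq_iff)
    then have Rf: "R f = g" using R(3)[OF g(1)] by simp
    have "N g \<le> B"
    proof (rule tendsto_lowerbound)
      show "(\<lambda>n. B + N (\<lambda>z. s n z - g z)) \<longlonglongrightarrow> B"
        using tendsto_add[OF tendsto_const g(2), of B] by simp
      have "N g \<le> B + N (\<lambda>z. s n z - g z)" for n
      proof -
        have "R (\<lambda>z. 0) = (\<lambda>z. 0)" using R_scale[OF zero_mem, of 0] by simp
        then have "s 0 = (\<lambda>z. 0)" by (simp add: s_def r0)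
        moreover have "B / 2 ^ n \<ge> 0" using B by simp
        ultimately have "N (s n) \<le> B" using tail[of 0 n] by simp
        then show ?thesis
          using norm_triangle_diff[OF sX diff_mem[OF sX g(1)], of n n] by simp
      qed
      then show "\<forall>\<^sub>F n in sequentially. N g \<le> B + N (\<lambda>z. s n z - g z)" by simp
    qed simp
    then show ?thesis by (simp add: Rf B_def)
  qed
  then show ?thesis
    unfolding bounded_operator_on_def using R(1) R_add R_scale by blast
qed

end

section \<open>Weighted composition by an automorphism\<close>

lemma disk_automorphism_inv:
  assumes "disk_automorphism \<phi>"
  shows "disk_automorphism (inv_into disk \<phi>)"
proof -
  have hol: "\<phi> holomorphic_on disk" and bij: "bij_betw \<phi> disk disk"
    using assms by (auto simp: disk_automorphism_def)
  obtain g where g: "g holomorphic_on (\<phi> ` disk)" "\<And>z. z \<in> disk \<Longrightarrow> g (\<phi> z) = z"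
    by (rule holomorphic_has_inverse[OF hol open_ball bij_betw_imp_inj_on[OF bij]]) (rule that)
  have surj: "\<phi> ` disk = disk" by (rule bij_betw_imp_surj_on[OF bij])
  have "g w = inv_into disk \<phi> w" if "w \<in> disk" for w
  proof -
    have "w \<in> \<phi> ` disk" using that surj by blast
    then show ?thesis
      using g(2)[OF inv_into_into, of w \<phi>] f_inv_into_f[of w \<phi> disk] by simp
  qed
  then have "inv_into disk \<phi> holomorphic_on disk"
    by (rule holomorphic_transform[OF g(1)[unfolded surj]])
  then show ?thesis by (simp add: disk_automorphism_def bij_betw_inv_into[OF bij])
qed

text \<open>
  The cancellation is pointwise on the disk, from \<open>\<phi> (\<psi> z) = z\<close> and \<open>\<psi> (\<phi> z) = z\<close>. Off the disk both
  operators produce zero, which is the value of \<open>f\<close> there.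
\<close>

lemma weighted_comp_op_inverse:
  assumes \<phi>: "disk_automorphism \<phi>" and F: "\<forall>z\<in>disk. F z \<noteq> 0" and f: "f \<in> analytic_on_disk"
  defines "\<psi> \<equiv> inv_into disk \<phi>"
  defines "G \<equiv> (\<lambda>z. 1 / (F \<circ> \<psi>) z)"
  shows "weighted_comp_op G \<psi> (weighted_comp_op F \<phi> f) = f"
    and "weighted_comp_op F \<phi> (weighted_comp_op G \<psi> f) = f"
proof -
  have bij: "bij_betw \<phi> disk disk" using \<phi> by (simp add: disk_automorphism_def)
  have 1: "\<phi> z \<in> disk" "\<psi> (\<phi> z) = z" if "z \<in> disk" for z
    using bij that by (auto simp: \<psi>_def bij_betw_def)
  have 2: "\<psi> z \<in> disk" "\<phi> (\<psi> z) = z" if "z \<in> disk" for z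
    using bij that unfolding \<psi>_def
    by (metis bij_betw_imp_surj_on inv_into_into) (metis bij_betw_inv_into_right bij that)
  have 0: "f z = 0" if "z \<notin> disk" for z using f that by (auto simp: analytic_on_disk_def)
  show "weighted_comp_op G \<psi> (weighted_comp_op F \<phi> f) = f"
    using 2 F 0 by (auto simp: weighted_comp_op_def on_disk_def G_def fun_eq_iff simp del: mem_ball)
  show "weighted_comp_op F \<phi> (weighted_comp_op G \<psi> f) = f"
    using 1 F 0 by (auto simp: weighted_comp_op_def on_disk_def G_def fun_eq_iff simp del: mem_ball)
qed

lemma bounded_operator_on_cong:
  assumes X: "analytic_banach_space X N" and R: "bounded_operator_on X N R"
    and eq: "\<And>f. f \<in> X \<Longrightarrow> S f = R f"
  shows "bounded_operator_on X N S"
  using R analytic_banach_space.add_mem[OF X] analytic_banach_space.scale_mem[OF X]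
  unfolding bounded_operator_on_def by (simp add: eq)

section \<open>Invertibility forces an automorphism\<close>

text \<open>
  If \<open>\<rho> > 1\<close>, any \<open>r\<close> strictly between \<open>1\<close> and \<open>\<rho>\<close> absorbs the constant: eventually
  \<open>r^n \<le> c \<rho>^n\<close>, and the upper limit of the roots is at least \<open>r\<close>.
\<close>

lemma geometric_lower_bound_le_one:
  fixes u :: "nat \<Rightarrow> real"
  assumes lim: "limsup (\<lambda>n. ereal (root n (u n))) \<le> 1"
    and c: "c > 0" and \<rho>: "\<rho> \<ge> 0" and low: "\<And>n. c * \<rho> ^ n \<le> u n"
  shows "\<rho> \<le> 1"
proof (rule ccontr)
  assume "\<not> \<rho> \<le> 1"
  then have "1 < \<rho>" by simp
  then obtain r where r: "1 < r" "r < \<rho>" using dense by blast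
  have "(\<lambda>n. (r / \<rho>) ^ n) \<longlonglongrightarrow> 0" using r by (intro LIMSEQ_power_zero) auto
  then have "\<forall>\<^sub>F n in sequentially. (r / \<rho>) ^ n < c" using order_tendstoD(2) c by blast
  then have "\<forall>\<^sub>F n in sequentially. ereal r \<le> ereal (root n (u n))"
    using eventually_gt_at_top[of 0]
  proof eventually_elim
    case (elim n)
    have "r ^ n \<le> c * \<rho> ^ n" using elim r by (simp add: power_divide field_simps)
    also have "\<dots> \<le> u n" by (rule low)
    finally have "root n (r ^ n) \<le> root n (u n)" using elim by simp
    then show ?case using elim r by (simp add: real_root_power_cancel)
  qed
  then have "ereal r \<le> limsup (\<lambda>n. ereal (root n (u n)))" by (intro le_Limsup) auto
  then have "ereal r \<le> 1" using lim by (rule order_trans)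
  then show False using r by simp
qed

locale polynomial_space = analytic_banach_space +
  assumes evaluation: "\<And>z. z \<in> disk \<Longrightarrow> \<exists>C. \<forall>f\<in>X. cmod (f z) \<le> C * N f"
    and poly_mem: "\<And>p. on_disk (poly p) \<in> X"
    and poly_dense: "\<And>f e. f \<in> X \<Longrightarrow> e > 0 \<Longrightarrow> \<exists>p. N (\<lambda>z. f z - on_disk (poly p) z) < e"
    and power_growth: "limsup (\<lambda>n. ereal (root n (N (on_disk (\<lambda>z. z ^ n))))) = 1"
begin

abbreviation pow :: "nat \<Rightarrow> complex \<Rightarrow> complex"
  where "pow k \<equiv> on_disk (\<lambda>z. z ^ k)"

lemma pow_mem: "pow k \<in> X"
proof -
  have "on_disk (poly (monom 1 k)) = pow k" by (auto simp: on_disk_def poly_monom)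
  then show ?thesis using poly_mem by metis
qed

lemma evaluation_operator_bound:
  assumes R: "bounded_operator_on X N R" and w: "w \<in> disk"
  obtains C where "C > 0" "\<And>f. f \<in> X \<Longrightarrow> cmod (R f w) \<le> C * N f"
proof -
  obtain C where C: "C > 0" "\<And>f. f \<in> X \<Longrightarrow> N (R f) \<le> C * N f"
    using operator_bound[OF R] by blast
  obtain D where D: "\<And>f. f \<in> X \<Longrightarrow> cmod (f w) \<le> D * N f" using evaluation[OF w] by blast
  have "cmod (R f w) \<le> ((\<bar>D\<bar> + 1) * C) * N f" if f: "f \<in> X" for f
  proof -
    have Rf: "R f \<in> X" using R f by (simp add: bounded_operator_on_def)
    have "cmod (R f w) \<le> D * N (R f)" by (rule D[OF Rf])
    also have "\<dots> \<le> (\<bar>D\<bar> + 1) * N (R f)" by (rule mult_right_mono) (auto simp: norm_nonneg Rf)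
    also have "\<dots> \<le> (\<bar>D\<bar> + 1) * (C * N f)" by (rule mult_left_mono) (auto simp: C f)
    finally show ?thesis by simp
  qed
  then show ?thesis using C by (intro that[of "(\<bar>D\<bar> + 1) * C"]) auto
qed

text \<open>
  The bounded functional \<open>f \<mapsto> (R f)(w)\<close> is determined by its values on the powers of \<open>z\<close>, since
  these span a dense subspace.
\<close>

lemma vanishes_if_vanishes_on_powers:
  assumes R: "bounded_operator_on X N R" and w: "w \<in> disk"
    and pow: "\<And>k. R (pow k) w = 0" and f: "f \<in> X"
  shows "R f w = 0"
proof -
  have lin: "R (\<lambda>z. g z + c * h z) w = R g w + c * R h w" if "g \<in> X" "h \<in> X" for g h c
    using operator_add[OF R that(1) scale_mem[OF that(2)]] operator_scale[OF R that(2)] by simp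
  have sum0: "R (on_disk (poly (\<Sum>i\<le>n. monom (c i) i))) w = 0" for c :: "nat \<Rightarrow> complex" and n
  proof (induction n)
    case 0
    have "on_disk (poly (\<Sum>i\<le>0. monom (c i) i)) = (\<lambda>z. c 0 * pow 0 z)"
      by (auto simp: on_disk_def poly_monom)
    then show ?case using operator_scale[OF R pow_mem, of "c 0" 0] pow[of 0] by simp
  next
    case (Suc n)
    have "on_disk (poly (\<Sum>i\<le>Suc n. monom (c i) i))
        = (\<lambda>z. on_disk (poly (\<Sum>i\<le>n. monom (c i) i)) z + c (Suc n) * pow (Suc n) z)"
      by (auto simp: on_disk_def poly_monom)
    then show ?case using lin[OF poly_mem pow_mem] Suc pow by (simp del: sum.atMost_Suc power_Suc)
  qed
  have poly0: "R (on_disk (poly p)) w = 0" for p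
    using sum0[of "coeff p" "degree p"] by (simp add: poly_as_sum_of_monoms)
  obtain C where C: "C > 0" "\<And>f. f \<in> X \<Longrightarrow> cmod (R f w) \<le> C * N f"
    using evaluation_operator_bound[OF R w] by blast
  have "cmod (R f w) \<le> 0 + e" if e: "e > 0" for e
  proof -
    obtain p where p: "N (\<lambda>z. f z - on_disk (poly p) z) < e / C"
      using poly_dense[OF f, of "e / C"] e C(1) by auto
    have "R f w = R (\<lambda>z. f z - on_disk (poly p) z) w"
      using operator_diff[OF R f poly_mem] poly0 by simp
    then have "cmod (R f w) \<le> C * N (\<lambda>z. f z - on_disk (poly p) z)"
      using C(2)[OF diff_mem[OF f poly_mem]] by simp
    also have "\<dots> \<le> e" using p C(1) by (simp add: field_simps)
    finally show ?thesis by simp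
  qed
  then have "cmod (R f w) \<le> 0" by (rule field_le_epsilon)
  then show ?thesis by simp
qed

text \<open>
  The quotient of \<open>R z\<close> by \<open>R 1\<close> continues the inverse of \<open>\<phi>\<close> analytically to the disk. The growth
  of the powers keeps its values inside the disk, which makes \<open>\<phi>\<close> surjective.
\<close>

lemma invertible_weighted_comp_op_imp:
  assumes symbols: "weighted_comp_symbols F \<phi>"
    and inv: "inverse_operator_on X N (weighted_comp_op F \<phi>) R"
    and T: "bounded_operator_on X N (weighted_comp_op F \<phi>)"
  shows "disk_automorphism \<phi>" and "\<forall>z\<in>disk. F z \<noteq> 0"
proof -
  have \<phi>: "\<phi> holomorphic_on disk" "\<And>z. z \<in> disk \<Longrightarrow> \<phi> z \<in> disk"
    using symbols unfolding weighted_comp_symbols_def by blast+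
  have R: "bounded_operator_on X N R" using inv by (simp add: inverse_operator_on_def)
  have R_hol: "R f holomorphic_on disk" if "f \<in> X" for f
    using R that analytic by (auto simp: bounded_operator_on_def analytic_on_disk_def)
  have eq: "F z * R f (\<phi> z) = f z" if "f \<in> X" "z \<in> disk" for f z
  proof -
    have "weighted_comp_op F \<phi> (R f) z = f z" using inv that by (simp add: inverse_operator_on_def)
    then show ?thesis using that(2) by (simp add: weighted_comp_op_def on_disk_def)
  qed
  define a b where "a = R (pow 0)" and "b = R (pow 1)"
  have a_hol: "a holomorphic_on disk" and b_hol: "b holomorphic_on disk"
    unfolding a_def b_def by (intro R_hol pow_mem)+
  have Rpow: "F z * R (pow k) (\<phi> z) = z ^ k" if "z \<in> disk" for k z
    using eq[OF pow_mem that, of k] that by (simp add: on_disk_def)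
  have Fa: "F z * a (\<phi> z) = 1" and Fb: "F z * b (\<phi> z) = z" if "z \<in> disk" for z
    using Rpow[OF that, of 0] Rpow[OF that, of 1] by (simp_all add: a_def b_def)
  show F0: "\<forall>z\<in>disk. F z \<noteq> 0" using Fa by fastforce
  have quot: "a (\<phi> z) \<noteq> 0" "b (\<phi> z) / a (\<phi> z) = z" if "z \<in> disk" for z
  proof -
    show "a (\<phi> z) \<noteq> 0" using Fa[OF that] by auto
    have "z * a (\<phi> z) = F z * a (\<phi> z) * b (\<phi> z)" using Fb[OF that] by (simp add: mult_ac)
    then show "b (\<phi> z) / a (\<phi> z) = z"
      using Fa[OF that] \<open>a (\<phi> z) \<noteq> 0\<close> by (simp add: field_simps)
  qed
  have inj: "inj_on \<phi> disk" by (rule inj_onI) (metis quot(2))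
  have open_im: "open (\<phi> ` disk)" by (rule open_mapping_thm3[OF \<phi>(1) open_ball inj])
  have im: "\<phi> ` disk \<noteq> {}" "\<phi> ` disk \<subseteq> disk" using \<phi>(2) by auto
  note identity = analytic_continuation_open[OF open_im open_ball im(1) connected_ball im(2)]
  \<comment> \<open>Multiplied out so that both sides are holomorphic before \<open>a\<close> is known to have no zeros.\<close>
  have power_identity: "a w ^ k * R (pow k) w = a w * b w ^ k" if w: "w \<in> disk" for k w
  proof (rule identity[OF _ _ _ w])
    show "(\<lambda>w. a w ^ k * R (pow k) w) holomorphic_on disk"
      by (intro holomorphic_intros a_hol R_hol pow_mem)
    show "(\<lambda>w. a w * b w ^ k) holomorphic_on disk"
      by (intro holomorphic_intros a_hol b_hol)
    fix w assume "w \<in> \<phi> ` disk"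
    then obtain z where z: "z \<in> disk" "w = \<phi> z" by blast
    have "R (pow k) w = a w * z ^ k"
      using Rpow[OF z(1), of k] Fa[OF z(1)] z(2) by (metis mult.commute mult.left_commute mult_1)
    moreover have "b w = a w * z" using quot[OF z(1)] z(2) by (simp add: field_simps)
    ultimately show "a w ^ k * R (pow k) w = a w * b w ^ k" by (simp add: power_mult_distrib)
  qed
  have R_pow_eq: "R (pow k) w = a w * (b w / a w) ^ k" if "w \<in> disk" "a w \<noteq> 0" for k w
    using power_identity[OF that(1), of k] that(2) by (simp add: power_divide field_simps)
  have quot_le: "cmod (b w / a w) \<le> 1" if w: "w \<in> disk" "a w \<noteq> 0" for w
  proof -
    obtain C where C: "C > 0" "\<And>f. f \<in> X \<Longrightarrow> cmod (R f w) \<le> C * N f"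
      using evaluation_operator_bound[OF R w(1)] by blast
    show ?thesis
    proof (rule geometric_lower_bound_le_one)
      show "limsup (\<lambda>n. ereal (root n (N (pow n)))) \<le> 1" using power_growth by simp
      show "cmod (a w) / C > 0" using w C by simp
      fix n
      show "cmod (a w) / C * cmod (b w / a w) ^ n \<le> N (pow n)"
        using C(2)[OF pow_mem, of n] C(1)
        unfolding R_pow_eq[OF w] norm_mult norm_power times_divide_eq_left
        by (simp only: pos_divide_le_eq mult.commute)
    qed simp
  qed
  \<comment> \<open>The zeros of \<open>a\<close> are isolated, so the bound passes to them in the limit.\<close>
  have R_pow_le: "cmod (R (pow k) w) \<le> cmod (a w)" if w: "w \<in> disk" for k w
  proof -
    have lim: "((\<lambda>v. cmod (h v)) \<longlongrightarrow> cmod (h w)) (at w)" if "h holomorphic_on disk" for h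
      using holomorphic_on_imp_continuous_on[OF that] w
      by (intro tendsto_norm) (simp add: continuous_on_eq_continuous_at isCont_def)
    have "a (\<phi> 0) \<noteq> 0" by (rule quot) simp
    then have "\<forall>\<^sub>F v in at w. a v \<noteq> 0 \<and> v \<in> disk"
      using non_zero_neighbour_alt[OF a_hol open_ball connected_ball w \<phi>(2)[of 0]] by simp
    then have "\<forall>\<^sub>F v in at w. cmod (R (pow k) v) \<le> cmod (a v)"
    proof eventually_elim
      case (elim v)
      then have "cmod (b v / a v) ^ k \<le> 1" using quot_le by (intro power_le_one) auto
      then show ?case
        using R_pow_eq[of v k] elim mult_left_mono[of "cmod (b v / a v) ^ k" 1 "cmod (a v)"]
        by (simp add: norm_mult norm_power)
    qed
    then show ?thesis
      by (intro tendsto_le[OF _ lim[OF a_hol] lim[OF R_hol[OF pow_mem]]]) auto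
  qed
  have a_nz: "a w \<noteq> 0" if w: "w \<in> disk" for w
  proof
    assume "a w = 0"
    then have zero: "R (pow k) w = 0" for k using R_pow_le[OF w, of k] by simp
    have "weighted_comp_op F \<phi> (pow 0) \<in> X" by (rule operator_mem[OF T pow_mem])
    from vanishes_if_vanishes_on_powers[OF R w zero this]
    have "pow 0 w = 0" using inv pow_mem[of 0] by (simp add: inverse_operator_on_def)
    then show False using w by (simp add: on_disk_def)
  qed
  define \<psi> where "\<psi> w = b w / a w" for w
  have \<psi>_hol: "\<psi> holomorphic_on disk"
    unfolding \<psi>_def by (intro holomorphic_intros a_hol b_hol a_nz)
  have \<psi>_\<phi>: "\<psi> (\<phi> z) = z" if "z \<in> disk" for z using quot(2)[OF that] by (simp add: \<psi>_def)
  have \<psi>_disk: "\<psi> w \<in> disk" if w: "w \<in> disk" for w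
  proof (rule ccontr)
    assume "\<psi> w \<notin> disk"
    then have "cmod (\<psi> v) \<le> cmod (\<psi> w)" if "v \<in> disk" for v
      using quot_le[OF that a_nz[OF that]] by (simp add: \<psi>_def)
    then have "\<psi> constant_on disk"
      by (intro maximum_modulus_principle[OF \<psi>_hol open_ball connected_ball open_ball order_refl w])
    then obtain c where "\<And>v. v \<in> disk \<Longrightarrow> \<psi> v = c" by (auto simp: constant_on_def)
    then have "z = c" if "z \<in> disk" for z using \<psi>_\<phi>[OF that] \<phi>(2)[OF that] by metis
    from this[of 0] this[of "1/2"] show False by simp
  qed
  have "\<phi> (\<psi> w) = w" if w: "w \<in> disk" for w
  proof (rule identity[OF _ _ _ w, of "\<lambda>w. \<phi> (\<psi> w)" "\<lambda>w. w"])
    show "(\<lambda>w. \<phi> (\<psi> w)) holomorphic_on disk"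
      using holomorphic_on_compose_gen[OF \<psi>_hol \<phi>(1) image_subsetI] \<psi>_disk
      by (simp add: o_def)
  qed (auto simp: \<psi>_\<phi> holomorphic_on_ident)
  then have "disk \<subseteq> \<phi> ` disk" using \<psi>_disk by (metis image_eqI subsetI)
  then show "disk_automorphism \<phi>"
    using \<phi> inj im by (auto simp: disk_automorphism_def bij_betw_def)
qed

end

section \<open>Invertible weighted composition operators\<close>

theorem theorem5:
  fixes X :: "(complex \<Rightarrow> complex) set"
    and N :: "(complex \<Rightarrow> complex) \<Rightarrow> real"
    and F \<phi> :: "complex \<Rightarrow> complex"
  assumes X: "analytic_banach_space X N"
    and Ax1: "\<forall>z\<in>disk. \<exists>C. \<forall>f\<in>X. cmod (f z) \<le> C * N f"
    and Ax2_mem: "\<forall>p :: complex poly. on_disk (poly p) \<in> X"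
    and Ax2_dense: "\<forall>f\<in>X. \<forall>e>0. \<exists>p :: complex poly. N (\<lambda>z. f z - on_disk (poly p) z) < e"
    and Ax3: "bounded_operator_on X N (mult_op (\<lambda>z. z))"
    and Ax4: "limsup (\<lambda>n. ereal (root n (N (on_disk (\<lambda>z. z ^ n))))) = 1"
    and symbols: "weighted_comp_symbols F \<phi>"
    and bounded: "bounded_operator_on X N (weighted_comp_op F \<phi>)"
  defines "\<psi> \<equiv> inv_into disk \<phi>"
  defines "G \<equiv> (\<lambda>z. 1 / (F \<circ> \<psi>) z)"
  shows
    "(invertible_operator_on X N (weighted_comp_op F \<phi>) \<longrightarrow>
        disk_automorphism \<phi> \<and> (\<forall>z\<in>disk. F z \<noteq> 0) \<and>
        weighted_comp_symbols G \<psi> \<and>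
        inverse_operator_on X N (weighted_comp_op F \<phi>) (weighted_comp_op G \<psi>)) \<and>
     ((\<forall>\<sigma>. disk_automorphism \<sigma> \<longrightarrow> bounded_operator_on X N (comp_op \<sigma>)) \<longrightarrow>
        (invertible_operator_on X N (weighted_comp_op F \<phi>) \<longleftrightarrow>
           disk_automorphism \<phi> \<and> (\<forall>z\<in>disk. F z \<noteq> 0) \<and> (\<lambda>z. 1 / F z) \<in> multipliers X) \<and>
        (invertible_operator_on X N (weighted_comp_op F \<phi>) \<longrightarrow>
           F \<in> multipliers X \<and>
           weighted_comp_symbols G \<psi> \<and>
           inverse_operator_on X N (weighted_comp_op F \<phi>) (weighted_comp_op G \<psi>)))"
proof -
  interpret analytic_banach_space X N by (rule X)
  interpret polynomial_space X N
    using Ax1 Ax2_mem Ax2_dense Ax4 by unfold_locales blast+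
  let ?T = "weighted_comp_op F \<phi>" and ?S = "weighted_comp_op G \<psi>"
  have F_hol: "F holomorphic_on disk" using symbols by (simp add: weighted_comp_symbols_def)
  have inverses: "?S (?T f) = f" "?T (?S f) = f"
    if "disk_automorphism \<phi>" "\<forall>z\<in>disk. F z \<noteq> 0" "f \<in> X" for f
    using weighted_comp_op_inverse[OF that(1,2), of f] that(3) analytic
    unfolding \<psi>_def G_def by auto
  have \<psi>_auto: "disk_automorphism \<psi>" if "disk_automorphism \<phi>"
    unfolding \<psi>_def by (rule disk_automorphism_inv[OF that])
  have cancel: "\<phi> z \<in> disk" "\<psi> (\<phi> z) = z" "\<psi> z \<in> disk" "\<phi> (\<psi> z) = z"
    if "disk_automorphism \<phi>" "z \<in> disk" for z
    using that \<psi>_auto[OF that(1)] bij_betw_inv_into_right[of \<phi> disk disk z]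
    by (auto simp: \<psi>_def disk_automorphism_def bij_betw_def simp del: mem_ball)
  have a: "disk_automorphism \<phi> \<and> (\<forall>z\<in>disk. F z \<noteq> 0) \<and> weighted_comp_symbols G \<psi> \<and>
        inverse_operator_on X N ?T ?S" if inv: "invertible_operator_on X N ?T"
  proof -
    obtain R where R: "inverse_operator_on X N ?T R"
      using inv by (auto simp: invertible_operator_on_def)
    have \<phi>: "disk_automorphism \<phi>" and F0: "\<forall>z\<in>disk. F z \<noteq> 0"
      using invertible_weighted_comp_op_imp[OF symbols R bounded] by auto
    have \<psi>: "\<psi> holomorphic_on disk" "\<psi> ` disk \<subseteq> disk"
      using \<psi>_auto[OF \<phi>] by (auto simp: disk_automorphism_def bij_betw_def)
    have "(F \<circ> \<psi>) holomorphic_on disk"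
      by (rule holomorphic_on_compose_gen[OF \<psi>(1) F_hol \<psi>(2)])
    moreover have "(F \<circ> \<psi>) z \<noteq> 0" if "z \<in> disk" for z using F0 \<psi>(2) that unfolding o_def by blast
    ultimately have "weighted_comp_symbols G \<psi>"
      unfolding weighted_comp_symbols_def G_def using \<psi> by (auto intro!: holomorphic_on_divide holomorphic_on_const simp del: o_apply)
    moreover have "?S f = R f" if "f \<in> X" for f
    proof -
      have "R f \<in> X" "?T (R f) = f"
        using R that by (auto simp: inverse_operator_on_def bounded_operator_on_def)
      then show ?thesis using inverses(1)[OF \<phi> F0, of "R f"] by simp
    qed
    then have "bounded_operator_on X N ?S"
      using bounded_operator_on_cong[OF X] R by (auto simp: inverse_operator_on_def)
    ultimately show ?thesis
      using \<phi> F0 inverses by (auto simp: inverse_operator_on_def)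
  qed
  \<comment> \<open>Composing with \<open>\<phi>\<close> after the inverse operator is multiplication by \<open>1 / F\<close>; applying \<open>T\<close> after
      composing with \<open>\<psi>\<close> is multiplication by \<open>F\<close>.\<close>
  have b: "(invertible_operator_on X N ?T \<longleftrightarrow>
           disk_automorphism \<phi> \<and> (\<forall>z\<in>disk. F z \<noteq> 0) \<and> (\<lambda>z. 1 / F z) \<in> multipliers X) \<and>
        (invertible_operator_on X N ?T \<longrightarrow> F \<in> multipliers X)"
    if Ax5: "\<And>\<sigma>. disk_automorphism \<sigma> \<Longrightarrow> bounded_operator_on X N (comp_op \<sigma>)"
  proof -
    have comp: "comp_op \<sigma> f \<in> X" if "disk_automorphism \<sigma>" "f \<in> X" for \<sigma> f
      using Ax5[OF that(1)] that(2) by (simp add: bounded_operator_on_def)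
    have "(\<lambda>z. 1 / F z) \<in> multipliers X \<and> F \<in> multipliers X" if inv: "invertible_operator_on X N ?T"
    proof -
      note A = a[OF inv]
      have \<phi>: "disk_automorphism \<phi>" and F0: "\<forall>z\<in>disk. F z \<noteq> 0" using A by auto
      have "mult_op (\<lambda>z. 1 / F z) f = comp_op \<phi> (?S f)" for f
        using cancel[OF \<phi>]
        by (auto simp: mult_op_def comp_op_def weighted_comp_op_def on_disk_def G_def fun_eq_iff
            simp del: mem_ball)
      moreover have "mult_op F f = ?T (comp_op \<psi> f)" for f
        using cancel[OF \<phi>]
        by (auto simp: mult_op_def comp_op_def weighted_comp_op_def on_disk_def fun_eq_iff
            simp del: mem_ball)
      moreover have "?S f \<in> X" if "f \<in> X" for f
        using A that by (auto simp: inverse_operator_on_def bounded_operator_on_def)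
      moreover have "?T f \<in> X" if "f \<in> X" for f
        using bounded that by (auto simp: bounded_operator_on_def)
      moreover have "(\<lambda>z. 1 / F z) holomorphic_on disk"
        using F0 by (intro holomorphic_intros F_hol) auto
      ultimately show ?thesis
        using comp \<phi> \<psi>_auto F_hol by (simp add: multipliers_def)
    qed
    moreover have "invertible_operator_on X N ?T"
      if \<phi>: "disk_automorphism \<phi>" and F0: "\<forall>z\<in>disk. F z \<noteq> 0" and M: "(\<lambda>z. 1 / F z) \<in> multipliers X"
    proof -
      have "?S f \<in> X" if f: "f \<in> X" for f
      proof -
        have "?S f = comp_op \<psi> (mult_op (\<lambda>z. 1 / F z) f)"
          using cancel[OF \<phi>]
          by (auto simp: mult_op_def comp_op_def weighted_comp_op_def on_disk_def G_def fun_eq_iff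
              simp del: mem_ball)
        then show ?thesis using comp \<psi>_auto[OF \<phi>] M f by (simp add: multipliers_def)
      qed
      then have "bounded_operator_on X N ?S"
        using inverses[OF \<phi> F0] by (intro bounded_inverse[OF bounded])
      then show ?thesis
        using bounded inverses[OF \<phi> F0]
        by (auto simp: invertible_operator_on_def inverse_operator_on_def)
    qed
    ultimately show ?thesis using a by blast
  qed
  show ?thesis using a b by blast
qed

end
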